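(* Let $m,p$ be positive integers and let $a,b,x$ be real numbers with $|a|=|b|>1$ and $|x|<|a|^{-1}$ (equivalently $|x|<|b|^{-1}$). Then \begin{align*} &(-1)^p\sum_{n=1}^\infty \frac{H_n^{(2)}(ax)H_n^{(m)}(b)}{a^n n^p}-(-1)^m\sum_{n=1}^\infty \frac{H_n^{(2)}(bx)H_n^{(p)}(a)}{b^n n^m}\\ =&\sum_{i=1}^{p-1}\sum_{j=1}^{p-i}(-1)^{i+j}\mathrm{Li}_{p+2-i-j}(ax)\,\mathrm{Li}_{i+j,m}(x,b)-\sum_{i=1}^{m-1}\sum_{j=1}^{m-i}(-1)^{i+j}\mathrm{Li}_{m+2-i-j}(bx)\,\mathrm{Li}_{i+j,p}(x,a)\\ &+(-1)^p p\ln(1-ax)\left(\mathrm{Li}_{p+1,m}(x,b)-\mathrm{Li}_{p+1,m}(a^{-1},b)\right)-(-1)^m m\ln(1-bx)\left(\mathrm{Li}_{m+1,p}(x,a)-\mathrm{Li}_{m+1,p}(b^{-1},a)\right)\\ &-(-1)^p p\sum_{n=1}^\infty \frac{H_n^{(1)}(ax)H_n^{(m)}(b)}{a^n n^{p+1}}+(-1)^m m\sum_{n=1}^\infty \frac{H_n^{(1)}(bx)H_n^{(p)}(a)}{b^n n^{m+1}}\\ &+(-1)^p\mathrm{Li}_2(ax)\,\mathrm{Li}_{p,m}(a^{-1},b)-(-1)^m\mathrm{Li}_2(bx)\,\mathrm{Li}_{m,p}(b^{-1},a). \end{align*}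
   Context: For a positive integer $p$ and real $a$, $H_n^{(p)}(a):=\sum_{j=1}^n \frac{a^j}{j^p}$. $\mathrm{Li}_p(x)=\sum_{n\ge1}x^n/n^p$ is the polylogarithm. For $s,t>0$ and $|x|\le 1$, $|y|>0$, $|xy|<1$ (with $|xy|=1$ allowed if $s>1$), $\mathrm{Li}_{s,t}(x,y):=\sum_{n=1}^\infty \frac{x^n}{n^s}\sum_{k=1}^n\frac{y^k}{k^t}$. *)

theory Defs
  imports "HOL-Analysis.Analysis"
begin

definition gen_harm :: "nat \<Rightarrow> nat \<Rightarrow> real \<Rightarrow> real" where
  "gen_harm p n a = (\<Sum>j=1..n. a ^ j / real j ^ p)"

definition polylog :: "nat \<Rightarrow> real \<Rightarrow> real" where
  "polylog p x = (\<Sum>n. x ^ Suc n / real (Suc n) ^ p)"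

text \<open>
  The usual domain is \<open>\<bar>x * y\<bar> < 1\<close>, or \<open>\<bar>x * y\<bar> = 1\<close> with \<open>s > 1\<close>. For \<open>\<bar>y\<bar> > 1\<close> the inner sum is
  \<open>O(\<bar>y\<bar> ^ n / n powr t)\<close>, so the series also converges absolutely when \<open>\<bar>x * y\<bar> = 1\<close>, \<open>s = 1\<close>
  and \<open>t > 0\<close>.
\<close>

definition dbl_polylog :: "real \<Rightarrow> real \<Rightarrow> real \<Rightarrow> real \<Rightarrow> real" where
  "dbl_polylog s t x y =
     (\<Sum>n. x ^ Suc n / real (Suc n) powr s * (\<Sum>k=1..Suc n. y ^ k / real k powr t))"

end

theory Submission
  imports Defs
begin

text \<open>
  The partial fraction expansion of \<open>1 / (r ^ p * (n + r)\<^sup>2)\<close> with respect to \<open>r\<close>, multiplied by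
  \<open>x ^ n * (a * x) ^ r * gen_harm m n b\<close> and summed over \<open>r\<close> and \<open>n\<close>, turns all the terms of the
  identity carrying the sign \<open>(-1) ^ p\<close>, and the first double sum, into the single series
  \<open>\<Sum>N. x ^ N / N\<^sup>2 * (\<Sum>k + r \<le> N. b ^ k / k ^ m * a ^ r / r ^ p)\<close>. This series does not change when
  \<open>(p, a)\<close> and \<open>(m, b)\<close> are exchanged. The condition \<open>\<bar>a\<bar> = \<bar>b\<bar>\<close> only serves convergence.
\<close>

section \<open>Partial fractions and the count of their coefficients\<close>

text \<open>As a function of \<open>r\<close> the left side has its poles at \<open>0\<close> and
  \<open>- u\<close>. The separate term in \<open>1 / r\<close> is the summand
  \<open>s = p + 1\<close>, kept apart because it yields the logarithm. The induction divides by
  \<open>r\<close> and resolves the resulting mixed products of poles.\<close>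

lemma partial_fraction_power_square:
  fixes r u :: real
  assumes "r > 0" "u > 0"
  shows "1 / (r ^ p * (u + r)\<^sup>2)
    = (\<Sum>s=2..p. real (s - 1) * ((-1) ^ s / (u ^ s * r ^ (p + 2 - s))))
      - (-1) ^ p * real p / (u ^ (p + 1) * r)
      + (-1) ^ p / (u ^ p * (u + r)\<^sup>2) + (-1) ^ p * real p / (u ^ (p + 1) * (u + r))"
proof (induction p)
  case 0
  then show ?case by simp
next
  case (Suc p)
  let ?t = "\<lambda>p s. real (s - 1) * ((-1) ^ s / (u ^ s * r ^ (p + 2 - s)))"
  define w e where "w = u + r" and "e = (-1) ^ p / u ^ p"
  \<comment> \<open>Division by \<open>r\<close> raises every exponent \<open>p + 2 - s\<close> by
    one, and the old simple pole at \<open>0\<close> supplies the new summand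
    \<open>s = Suc p\<close>.\<close>
  have S: "(\<Sum>s=2..Suc p. ?t (Suc p) s) = (\<Sum>s=2..p. ?t p s) / r - e * real p / (u * r\<^sup>2)"
  proof (cases "p = 0")
    case False
    then have "(\<Sum>s=2..Suc p. ?t (Suc p) s) = (\<Sum>s=2..p. ?t (Suc p) s) + ?t (Suc p) (Suc p)"
      by (subst sum.cl_ivl_Suc) simp
    moreover have "(\<Sum>s=2..p. ?t (Suc p) s) = (\<Sum>s=2..p. ?t p s) / r"
      unfolding sum_divide_distrib
      by (intro sum.cong refl) (simp add: Suc_diff_le)
    ultimately show ?thesis
      by (simp add: e_def power2_eq_square mult_ac del: sum.cl_ivl_Suc)
  qed simp
  have split: "1 / (w\<^sup>2 * r) = 1 / (u\<^sup>2 * r) - 1 / (u * w\<^sup>2) - 1 / (u\<^sup>2 * w)"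
    "1 / (w * r) = 1 / (u * r) - 1 / (u * w)"
    using assms by (simp_all add: w_def divide_simps) (simp_all add: power2_eq_square algebra_simps)
  have "1 / (r ^ Suc p * w\<^sup>2) = (1 / (r ^ p * w\<^sup>2)) / r"
    by simp
  also have "\<dots> = (\<Sum>s=2..p. ?t p s) / r - e * real p / (u * r\<^sup>2)
      + e * (1 / (w\<^sup>2 * r)) + e * real p / u * (1 / (w * r))"
    unfolding w_def Suc.IH by (simp add: e_def add_divide_distrib diff_divide_distrib power2_eq_square mult_ac)
  also have "\<dots> = (\<Sum>s=2..Suc p. ?t (Suc p) s)
      + e * (1 / (u\<^sup>2 * r) - 1 / (u * w\<^sup>2) - 1 / (u\<^sup>2 * w)) + e * real p / u * (1 / (u * r) - 1 / (u * w))"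
    unfolding S split ..
  also have "\<dots> = (\<Sum>s=2..Suc p. ?t (Suc p) s) + e * real (Suc p) / (u\<^sup>2 * r)
      - e / (u * w\<^sup>2) - e * real (Suc p) / (u\<^sup>2 * w)"
    by (simp add: right_diff_distrib distrib_left add_divide_distrib power2_eq_square)
  also have "\<dots> = (\<Sum>s=2..Suc p. ?t (Suc p) s) - (-1) ^ Suc p * real (Suc p) / (u ^ (Suc p + 1) * r)
      + (-1) ^ Suc p / (u ^ Suc p * w\<^sup>2) + (-1) ^ Suc p * real (Suc p) / (u ^ (Suc p + 1) * w)"
    by (simp add: e_def power2_eq_square mult_ac del: of_nat_Suc sum.cl_ivl_Suc)
  finally show ?case
    unfolding w_def .
qed

text \<open>Exactly \<open>s - 1\<close> pairs of positive \<open>i\<close> and \<open>j\<close>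
  satisfy \<open>i + j = s\<close>. In this way the partial fraction coefficients become the double
  sums of the theorem.\<close>

lemma sum_nested_eq_weighted_sum:
  fixes f :: "nat \<Rightarrow> real"
  shows "(\<Sum>i=1..p-1. \<Sum>j=1..p-i. f (i + j)) = (\<Sum>s=2..p. real (s - 1) * f s)"
proof (induction p)
  case (Suc p)
  show ?case
  proof (cases "p = 0")
    case False
    \<comment> \<open>Each row gains the single index \<open>j = Suc p - i\<close>, with value
      \<open>f (Suc p)\<close>.\<close>
    have "(\<Sum>i=1..p. \<Sum>j=1..Suc p-i. f (i + j)) = (\<Sum>i=1..p. (\<Sum>j=1..p-i. f (i + j)) + f (Suc p))"
      by (intro sum.cong) (simp_all add: Suc_diff_le)
    also have "\<dots> = (\<Sum>i=1..p. \<Sum>j=1..p-i. f (i + j)) + real p * f (Suc p)"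
      by (simp add: sum.distrib)
    \<comment> \<open>The row \<open>i = p\<close> is empty.\<close>
    also have "(\<Sum>i=1..p. \<Sum>j=1..p-i. f (i + j)) = (\<Sum>i=1..p-1. \<Sum>j=1..p-i. f (i + j))"
      using False by (intro sum.mono_neutral_right) auto
    finally show ?thesis
      using False Suc.IH by simp
  qed simp
qed simp

section \<open>Polylogarithm series, their partial sums and tails\<close>

lemma summable_polylog:
  assumes "\<bar>y\<bar> < 1"
  shows "summable (\<lambda>r. \<bar>y ^ Suc r / real (Suc r) ^ q\<bar>)"
proof (rule summable_comparison_test')
  show "summable (\<lambda>r. \<bar>y\<bar> ^ r)"
    using assms by (simp add: summable_geometric)
  fix r :: nat
  have "\<bar>y\<bar> ^ Suc r \<le> \<bar>y\<bar> ^ r"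
    using assms by (simp add: mult_left_le_one_le)
  moreover have "1 \<le> real (Suc r) ^ q"
    by (rule one_le_power) simp
  ultimately have "\<bar>y\<bar> ^ Suc r / real (Suc r) ^ q \<le> \<bar>y\<bar> ^ r / 1"
    by (intro frac_le) auto
  then show "norm \<bar>y ^ Suc r / real (Suc r) ^ q\<bar> \<le> \<bar>y\<bar> ^ r"
    by (simp add: power_abs abs_mult)
qed

lemma sums_polylog:
  assumes "\<bar>y\<bar> < 1"
  shows "(\<lambda>r. y ^ Suc r / real (Suc r) ^ q) sums polylog q y"
  unfolding polylog_def
  by (rule summable_sums, rule summable_rabs_cancel, rule summable_polylog, rule assms)

lemma gen_harm_eq_lessThan: "gen_harm q n y = (\<Sum>j<n. y ^ Suc j / real (Suc j) ^ q)"
  unfolding gen_harm_def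
  by (rule sum.reindex_bij_witness[of _ Suc "\<lambda>j. j - 1"]) auto

lemma gen_harm_tendsto_polylog:
  assumes "\<bar>y\<bar> < 1"
  shows "(\<lambda>n. gen_harm q n y) \<longlonglongrightarrow> polylog q y"
  using sums_polylog[OF assms] by (simp add: sums_def gen_harm_eq_lessThan)

text \<open>Serves the pole \<open>r = - n\<close>: a series in \<open>n + r\<close> is a shifted
  tail, and its missing initial segment is the source of the harmonic numbers in
  \<open>a * x\<close>.\<close>

lemma sums_polylog_tail:
  assumes "\<bar>y\<bar> < 1"
  shows "(\<lambda>r. y ^ (n + Suc r) / real (n + Suc r) ^ q) sums (polylog q y - gen_harm q n y)"
  using sums_split_initial_segment[OF sums_polylog[OF assms, of q], of n]
  by (simp add: gen_harm_eq_lessThan add.commute)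

lemma polylog_1:
  assumes "\<bar>y\<bar> < 1"
  shows "polylog 1 y = - ln (1 - y)"
proof -
  have "(\<lambda>n. - (y ^ n) / real n) sums ln (1 - y)"
    using ln_series'[of "-y"] assms by simp
  from sums_minus[OF this]
  have "(\<lambda>n. y ^ n / real n) sums (- ln (1 - y))"
    by simp
  \<comment> \<open>The summand at \<open>n = 0\<close> is a division by zero, hence
    \<open>0\<close>, so the shift does not change the value.\<close>
  then have "(\<lambda>n. y ^ Suc n / real (Suc n)) sums (- ln (1 - y))"
    by (subst sums_Suc_iff) simp
  then show ?thesis
    using sums_polylog[OF assms, of 1] by (simp add: sums_unique2)
qed

section \<open>Convergence of double polylogarithms\<close>

text \<open>Since \<open>k ^ m * n ^ s \<ge> k\<^sup>2\<close> for \<open>1 \<le> k \<le> n\<close>, the series is dominated by the Cauchy product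
  of \<open>\<Sum>1 / k\<^sup>2\<close> with the geometric series in \<open>\<bar>z\<bar>\<close>; this covers the boundary case
  \<open>\<bar>b * z\<bar> = 1\<close> with \<open>m = s = 1\<close>.\<close>

lemma summable_dbl_polylog:
  fixes b z :: real
  assumes z: "\<bar>z\<bar> < 1" and bz: "\<bar>b * z\<bar> \<le> 1" and ms: "m + s \<ge> 2"
  shows "summable (\<lambda>n. \<bar>z ^ Suc n / real (Suc n) ^ s * gen_harm m (Suc n) b\<bar>)"
proof (rule summable_comparison_test')
  have "summable (\<lambda>k. inverse (real k ^ 2))"
    by (rule inverse_power_summable) simp
  then have "summable (\<lambda>k. inverse (real (Suc k) ^ 2))"
    by (subst summable_Suc_iff)
  moreover have "summable (\<lambda>q. \<bar>z\<bar> ^ q)"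
    using z by (simp add: summable_geometric)
  ultimately show "summable (\<lambda>n. \<Sum>k\<le>n. inverse (real (Suc k) ^ 2) * \<bar>z\<bar> ^ (n - k))"
    by (intro sums_summable[OF Cauchy_product_sums]) (simp_all add: power_abs)
next
  fix n :: nat
  have "\<bar>z ^ Suc n / real (Suc n) ^ s * (b ^ Suc k / real (Suc k) ^ m)\<bar>
      \<le> inverse (real (Suc k) ^ 2) * \<bar>z\<bar> ^ (n - k)" if "k \<le> n" for k
  proof -
    have "real (Suc k) ^ 2 \<le> real (Suc k) ^ (m + s)"
      using ms by (intro power_increasing) auto
    also have "\<dots> \<le> real (Suc n) ^ s * real (Suc k) ^ m"
      using that by (simp add: power_add mult_right_mono power_mono)
    finally have den: "real (Suc k) ^ 2 \<le> real (Suc n) ^ s * real (Suc k) ^ m" .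
    \<comment> \<open>Pairing \<open>b ^ Suc k\<close> with \<open>Suc k\<close> of the factors
      \<open>z\<close> gives a power of a number at most 1 and leaves the geometric factor.\<close>
    have "\<bar>z ^ Suc n * b ^ Suc k\<bar> = \<bar>b * z\<bar> ^ Suc k * \<bar>z\<bar> ^ (n - k)"
    proof -
      have "Suc n = Suc k + (n - k)" using that by simp
      then have "\<bar>z\<bar> ^ Suc n = \<bar>z\<bar> ^ Suc k * \<bar>z\<bar> ^ (n - k)"
        by (metis power_add)
      then show ?thesis
        by (simp add: abs_mult power_abs power_mult_distrib mult_ac del: power_Suc)
    qed
    also have "\<dots> \<le> 1 * \<bar>z\<bar> ^ (n - k)"
      using bz by (intro mult_right_mono power_le_one) auto
    finally have "\<bar>z ^ Suc n * b ^ Suc k\<bar> / (real (Suc n) ^ s * real (Suc k) ^ m)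
        \<le> (1 * \<bar>z\<bar> ^ (n - k)) / real (Suc k) ^ 2"
      using den by (intro frac_le) auto
    then show ?thesis
      by (simp add: abs_mult power_abs field_simps)
  qed
  then have bound: "(\<Sum>k\<le>n. \<bar>z ^ Suc n / real (Suc n) ^ s * (b ^ Suc k / real (Suc k) ^ m)\<bar>)
      \<le> (\<Sum>k\<le>n. inverse (real (Suc k) ^ 2) * \<bar>z\<bar> ^ (n - k))"
    by (intro sum_mono) auto
  have "z ^ Suc n / real (Suc n) ^ s * gen_harm m (Suc n) b
      = (\<Sum>k\<le>n. z ^ Suc n / real (Suc n) ^ s * (b ^ Suc k / real (Suc k) ^ m))"
    unfolding gen_harm_eq_lessThan sum_distrib_left lessThan_Suc_atMost ..
  then show "norm \<bar>z ^ Suc n / real (Suc n) ^ s * gen_harm m (Suc n) b\<bar>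
      \<le> (\<Sum>k\<le>n. inverse (real (Suc k) ^ 2) * \<bar>z\<bar> ^ (n - k))"
    by (simp only: real_norm_def abs_idempotent) (rule order_trans[OF sum_abs bound])
qed

lemma sums_dbl_polylog:
  fixes b z :: real
  assumes "\<bar>z\<bar> < 1" "\<bar>b * z\<bar> \<le> 1" "m + s \<ge> 2"
  shows "(\<lambda>n. z ^ Suc n / real (Suc n) ^ s * gen_harm m (Suc n) b)
    sums dbl_polylog (real s) (real m) z b"
proof -
  have "dbl_polylog (real s) (real m) z b
      = (\<Sum>n. z ^ Suc n / real (Suc n) ^ s * gen_harm m (Suc n) b)"
    unfolding dbl_polylog_def gen_harm_def
    by (intro suminf_cong arg_cong2[where f = "(*)"] sum.cong refl) (simp_all add: powr_realpow)
  then show ?thesis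
    using summable_rabs_cancel[OF summable_dbl_polylog[OF assms]] by (simp add: summable_sums)
qed

section \<open>Rearrangement of double series\<close>

lemma summable_on_product_nonneg:
  fixes f g :: "nat \<Rightarrow> real"
  assumes "summable f" "summable g" and nonneg: "\<And>n. f n \<ge> 0" "\<And>n. g n \<ge> 0"
  shows "(\<lambda>(n, r). f n * g r) summable_on UNIV \<times> UNIV"
proof -
  have "f summable_on UNIV" "g summable_on UNIV"
    using assms by (simp_all add: summable_on_UNIV_nonneg_real_iff)
  then obtain S where "(g has_sum S) UNIV"
    by (auto simp: summable_on_def)
  then show ?thesis
    by (intro summable_on_SigmaI[where g = "\<lambda>n. f n * S"])
       (auto intro!: has_sum_cmult_right summable_on_cmult_left mult_nonneg_nonneg \<open>f summable_on UNIV\<close> nonneg)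
qed

text \<open>Both iterated sums equal the unordered sum of \<open>f\<close>: once by rows, once after
  reindexing the pairs by the diagonal \<open>N = n + r\<close>.\<close>

lemma suminf_rows_eq_diagonals:
  fixes f :: "nat \<times> nat \<Rightarrow> real"
  assumes f: "f summable_on UNIV" and rows: "\<And>n. (\<lambda>r. f (n, r)) sums F n"
  shows "suminf F = (\<Sum>N. \<Sum>r\<le>N. f (N - r, r))"
proof -
  obtain S where S: "(f has_sum S) UNIV"
    using f by (auto simp: summable_on_def)
  \<comment> \<open>Unordered summability of \<open>f\<close> restricts to each row; uniqueness of
    limits identifies the row value with \<open>F n\<close>.\<close>
  have row: "((\<lambda>r. f (n, r)) has_sum F n) UNIV" for n
  proof -
    have "(\<lambda>(n, r). f (n, r)) summable_on (Sigma UNIV (\<lambda>_. UNIV))"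
      using f by simp
    then have "(\<lambda>r. f (n, r)) summable_on UNIV"
      by (rule summable_on_SigmaD1[where x = n]) simp
    then obtain t where t: "((\<lambda>r. f (n, r)) has_sum t) UNIV"
      by (auto simp: summable_on_def)
    then show ?thesis
      using sums_unique2[OF has_sum_imp_sums[OF t] rows[of n]] by simp
  qed
  have "(F has_sum S) UNIV"
    by (rule has_sum_SigmaD[of f]) (use S row in auto)
  moreover have "((\<lambda>N. \<Sum>r\<le>N. f (N - r, r)) has_sum S) UNIV"
  proof (rule has_sum_SigmaD)
    have "bij_betw (\<lambda>(N, r). (N - r, r)) (Sigma UNIV atMost) (UNIV :: (nat \<times> nat) set)"
      by (rule bij_betw_byWitness[where f' = "\<lambda>(n, r). (n + r, r)"]) auto
    from has_sum_reindex_bij_betw[OF this, of f S] S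
    show "((\<lambda>(N, r). f (N - r, r)) has_sum S) (Sigma UNIV atMost)"
      by (simp add: case_prod_unfold)
  qed (auto intro: has_sum_finiteI)
  ultimately show ?thesis
    by (auto dest!: has_sum_imp_sums simp: sums_iff)
qed

section \<open>Sums over a triangle of indices\<close>

text \<open>Both indices are shifted by one: in terms of \<open>Suc r\<close> and
  \<open>Suc k\<close> the region is a sum of at most \<open>N + 2\<close>, hence the later weight
  with \<open>N + 2\<close>.\<close>

definition triangle_sum :: "nat \<Rightarrow> nat \<Rightarrow> real \<Rightarrow> real \<Rightarrow> nat \<Rightarrow> real" where
  "triangle_sum p m a b N =
     (\<Sum>r\<le>N. \<Sum>k\<le>N - r. a ^ Suc r / real (Suc r) ^ p * (b ^ Suc k / real (Suc k) ^ m))"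

text \<open>The region \<open>r + k \<le> N\<close> is symmetric in its two indices. This lets the
  two series cancel in the theorem.\<close>

lemma triangle_sum_commute: "triangle_sum p m a b N = triangle_sum m p b a N"
proof -
  \<comment> \<open>The dependent range is written as a restriction of the square, the form in which
    the order of summation can be swapped.\<close>
  have *: "{..N - r} = {k. k \<in> {..N} \<and> r + k \<le> N}" if "r \<le> N" for r
    using that by auto
  have "triangle_sum p m a b N = (\<Sum>r\<le>N. \<Sum>k | k \<in> {..N} \<and> r + k \<le> N.
      a ^ Suc r / real (Suc r) ^ p * (b ^ Suc k / real (Suc k) ^ m))"
    unfolding triangle_sum_def by (intro sum.cong refl *) simp
  also have "\<dots> = (\<Sum>k\<le>N. \<Sum>r | r \<in> {..N} \<and> r + k \<le> N.
      a ^ Suc r / real (Suc r) ^ p * (b ^ Suc k / real (Suc k) ^ m))"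
    by (rule sum.swap_restrict) simp_all
  also have "\<dots> = triangle_sum m p b a N"
    unfolding triangle_sum_def
    by (intro sum.cong refl) (auto simp: mult.commute)
  finally show ?thesis .
qed

section \<open>Evaluation of the double series by rows and by diagonals\<close>

text \<open>The factor \<open>gen_harm q (Suc n) y\<close> converges, hence is bounded, so the
  absolute convergence of the double polylogarithm carries over.\<close>

lemma summable_gen_harm_dbl_polylog:
  fixes b y z :: real
  assumes y: "\<bar>y\<bar> < 1" and z: "\<bar>z\<bar> < 1" "\<bar>b * z\<bar> \<le> 1" "m + s \<ge> 2"
  shows "summable (\<lambda>n. z ^ Suc n / real (Suc n) ^ s * gen_harm m (Suc n) b * gen_harm q (Suc n) y)"
proof -
  have "Bseq (\<lambda>n. gen_harm q n y)"
    using gen_harm_tendsto_polylog[OF y] convergentI convergent_imp_Bseq by blast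
  then obtain K where K: "\<And>n. \<bar>gen_harm q n y\<bar> \<le> K"
    by (auto simp: Bseq_def)
  show ?thesis
  proof (rule summable_comparison_test')
    show "summable (\<lambda>n. \<bar>z ^ Suc n / real (Suc n) ^ s * gen_harm m (Suc n) b\<bar> * K)"
      by (intro summable_mult2 summable_dbl_polylog z)
  next
    fix n
    show "norm (z ^ Suc n / real (Suc n) ^ s * gen_harm m (Suc n) b * gen_harm q (Suc n) y)
        \<le> \<bar>z ^ Suc n / real (Suc n) ^ s * gen_harm m (Suc n) b\<bar> * K"
      unfolding real_norm_def
      by (subst abs_mult) (intro mult_left_mono K, simp)
  qed
qed

text \<open>The family \<open>f\<close> is summed by rows for the left side and by diagonals for the
  right side, up to a common sign. One half of the theorem is collected here, so that the other half
  is the same statement with the parameters exchanged.\<close>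

lemma sum_terms_eq_triangle_series:
  fixes m p :: nat and a b x :: real
  assumes m: "m \<ge> 1" and p: "p \<ge> 1"
    and ab: "\<bar>a\<bar> = \<bar>b\<bar>" and b: "\<bar>b\<bar> > 1"
    and x: "\<bar>x\<bar> < inverse \<bar>a\<bar>"
  shows
    "(-1) ^ p * (\<Sum>n. gen_harm 2 (Suc n) (a * x) * gen_harm m (Suc n) b
                        / (a ^ Suc n * real (Suc n) ^ p))
     - (\<Sum>i=1..p-1. \<Sum>j=1..p-i.
          (-1) ^ (i + j) * polylog (p + 2 - i - j) (a * x) * dbl_polylog (real (i + j)) (real m) x b)
     - (-1) ^ p * real p * ln (1 - a * x)
         * (dbl_polylog (real (p + 1)) (real m) x b - dbl_polylog (real (p + 1)) (real m) (inverse a) b)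
     + (-1) ^ p * real p * (\<Sum>n. gen_harm 1 (Suc n) (a * x) * gen_harm m (Suc n) b
                        / (a ^ Suc n * real (Suc n) ^ (p + 1)))
     - (-1) ^ p * polylog 2 (a * x) * dbl_polylog (real p) (real m) (inverse a) b
     = - (\<Sum>N. x ^ (N + 2) / (real (N + 2))\<^sup>2 * triangle_sum p m a b N)"
proof -
  define y z where "y = a * x" and "z = inverse a"
  define H where "H = (\<lambda>n. gen_harm m (Suc n) b)"
  define D where "D = (\<lambda>s t. dbl_polylog (real s) (real m) t b)"
  define G where "G = (\<lambda>s q n. z ^ Suc n / real (Suc n) ^ s * H n * gen_harm q (Suc n) y)"
  define f where "f = (\<lambda>(n, r). (x ^ Suc n * H n) * (y ^ Suc r / real (Suc r) ^ p) / (real (Suc n) + real (Suc r))\<^sup>2)"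
  have a: "\<bar>a\<bar> > 1" using ab b by simp
  then have a0: "a \<noteq> 0" by auto
  have xz: "x = y * z"
    using a0 by (simp add: y_def z_def)
  have y: "\<bar>y\<bar> < 1"
    using x a by (simp add: y_def abs_mult field_simps)
  have z: "\<bar>z\<bar> < 1"
    using a by (simp add: z_def abs_inverse inverse_less_1_iff)
  \<comment> \<open>Since \<open>\<bar>a\<bar> = \<bar>b\<bar>\<close>, the point \<open>z\<close>
    lies exactly on the boundary of convergence.\<close>
  have bz: "\<bar>b * z\<bar> \<le> 1"
    using ab b by (simp add: z_def abs_mult abs_inverse)
  have x1: "\<bar>x\<bar> < 1"
    using x z by (simp add: z_def abs_inverse)
  have bx: "\<bar>b * x\<bar> \<le> 1"
    using y ab by (simp add: y_def abs_mult)
  have Dx: "(\<lambda>n. x ^ Suc n / real (Suc n) ^ s * H n) sums D s x" if "s \<ge> 1" for s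
    unfolding H_def D_def using that m by (intro sums_dbl_polylog x1 bx) auto
  have Dz: "(\<lambda>n. z ^ Suc n / real (Suc n) ^ s * H n) sums D s z" if "s \<ge> 1" for s
    unfolding H_def D_def using that m by (intro sums_dbl_polylog z bz) auto
  have G: "G s q sums suminf (G s q)" if "s \<ge> 1" for s q
    unfolding G_def H_def
    using that m by (intro summable_sums summable_gen_harm_dbl_polylog y z bz) auto
  have G_eq: "(\<Sum>n. gen_harm q (Suc n) (a * x) * gen_harm m (Suc n) b / (a ^ Suc n * real (Suc n) ^ s))
      = suminf (G s q)" for s q
    by (simp add: G_def H_def y_def z_def field_simps power_inverse del: power_Suc)

  have f_summable: "f summable_on UNIV"
  proof -
    \<comment> \<open>Dropping \<open>r\<close> from the squared denominator decouples the indices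
      and leaves a product of two summable sequences.\<close>
    let ?A = "\<lambda>n. \<bar>x ^ Suc n / real (Suc n) ^ 2 * H n\<bar>"
    let ?B = "\<lambda>r. \<bar>y ^ Suc r / real (Suc r) ^ p\<bar>"
    have "summable ?A"
      unfolding H_def using m by (intro summable_dbl_polylog x1 bx) auto
    then have "(\<lambda>(n, r). ?A n * ?B r) summable_on UNIV \<times> UNIV"
      by (intro summable_on_product_nonneg summable_polylog y) simp_all
    then have "(\<lambda>nr. norm (f nr)) summable_on UNIV \<times> UNIV"
    proof (rule summable_on_comparison_test)
      fix nr :: "nat \<times> nat"
      obtain n r where nr: "nr = (n, r)" by force
      have "(real (Suc n))\<^sup>2 \<le> (real (Suc n) + real (Suc r))\<^sup>2"
        by (intro power_mono) auto
      then have "\<bar>(x ^ Suc n * H n) * (y ^ Suc r / real (Suc r) ^ p)\<bar> / (real (Suc n) + real (Suc r))\<^sup>2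
          \<le> \<bar>(x ^ Suc n * H n) * (y ^ Suc r / real (Suc r) ^ p)\<bar> / (real (Suc n))\<^sup>2"
        by (intro divide_left_mono) auto
      then show "norm (f nr) \<le> (case nr of (n, r) \<Rightarrow> ?A n * ?B r)"
        by (simp add: nr f_def abs_mult mult.commute mult.left_commute del: power_Suc of_nat_Suc)
    qed simp
    then have "f summable_on UNIV \<times> UNIV"
      by (rule abs_summable_summable)
    then show ?thesis
      by simp
  qed

  \<comment> \<open>The row sums read off from the partial fractions: the pole \<open>r = 0\<close>
    gives full polylogarithms with weight \<open>x ^ Suc n\<close>, the pole \<open>r = - n\<close>
    gives tails with weight \<open>z ^ Suc n\<close>.\<close>
  define F where "F = (\<lambda>n.
      (\<Sum>s=2..p. real (s - 1) * ((-1) ^ s * polylog (p + 2 - s) y * (x ^ Suc n / real (Suc n) ^ s * H n)))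
      - (-1) ^ p * real p * polylog 1 y * (x ^ Suc n / real (Suc n) ^ (p + 1) * H n)
      + (-1) ^ p * (polylog 2 y * (z ^ Suc n / real (Suc n) ^ p * H n) - G p 2 n)
      + (-1) ^ p * real p * (polylog 1 y * (z ^ Suc n / real (Suc n) ^ (p + 1) * H n) - G (p + 1) 1 n))"
  have rows: "(\<lambda>r. f (n, r)) sums F n" for n
  proof -
    let ?u = "real (Suc n)"
    have pole_0: "(\<lambda>r. c * (x ^ Suc n / ?u ^ s * H n) * (y ^ Suc r / real (Suc r) ^ q))
        sums (c * (x ^ Suc n / ?u ^ s * H n) * polylog q y)" for c s q
      by (intro sums_mult sums_polylog y)
    have pole_u: "(\<lambda>r. c * (z ^ Suc n / ?u ^ s * H n) * (y ^ (Suc n + Suc r) / real (Suc n + Suc r) ^ q))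
        sums (c * (z ^ Suc n / ?u ^ s * H n) * (polylog q y - gen_harm q (Suc n) y))" for c s q
      by (intro sums_mult sums_polylog_tail y)
    have f_eq: "f (n, r) =
        (\<Sum>s=2..p. (real (s - 1) * (-1) ^ s) * (x ^ Suc n / ?u ^ s * H n) * (y ^ Suc r / real (Suc r) ^ (p + 2 - s)))
        - ((-1) ^ p * real p) * (x ^ Suc n / ?u ^ (p + 1) * H n) * (y ^ Suc r / real (Suc r) ^ 1)
        + (-1) ^ p * (z ^ Suc n / ?u ^ p * H n) * (y ^ (Suc n + Suc r) / real (Suc n + Suc r) ^ 2)
        + ((-1) ^ p * real p) * (z ^ Suc n / ?u ^ (p + 1) * H n) * (y ^ (Suc n + Suc r) / real (Suc n + Suc r) ^ 1)"
      for r
    proof -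
      let ?v = "real (Suc r)"
      let ?c = "x ^ Suc n * H n * y ^ Suc r"
      \<comment> \<open>The relation \<open>x = y * z\<close> raises the exponent of
        \<open>y\<close> to match the denominator \<open>n + r\<close>, so that a tail of the series
        in \<open>y\<close> appears.\<close>
      have xy: "z ^ Suc n * y ^ (Suc n + Suc r) = x ^ Suc n * y ^ Suc r"
        by (simp only: xz power_add power_mult_distrib mult_ac)
      have "f (n, r) = ?c * (1 / (?v ^ p * (?u + ?v)\<^sup>2))"
        by (simp add: f_def del: power_Suc of_nat_Suc)
      also have "\<dots> = ?c * (\<Sum>s=2..p. real (s - 1) * ((-1) ^ s / (?u ^ s * ?v ^ (p + 2 - s))))
          - ?c * ((-1) ^ p * real p / (?u ^ (p + 1) * ?v))
          + ?c * ((-1) ^ p / (?u ^ p * (?u + ?v)\<^sup>2))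
          + ?c * ((-1) ^ p * real p / (?u ^ (p + 1) * (?u + ?v)))"
        by (subst partial_fraction_power_square) (simp_all only: distrib_left right_diff_distrib of_nat_0_less_iff zero_less_Suc)
      also have "?c * (\<Sum>s=2..p. real (s - 1) * ((-1) ^ s / (?u ^ s * ?v ^ (p + 2 - s))))
          = (\<Sum>s=2..p. (real (s - 1) * (-1) ^ s) * (x ^ Suc n / ?u ^ s * H n) * (y ^ Suc r / ?v ^ (p + 2 - s)))"
        unfolding sum_distrib_left
        by (intro sum.cong refl) (simp add: mult_ac del: power_Suc of_nat_Suc)
      also have "?c * ((-1) ^ p * real p / (?u ^ (p + 1) * ?v))
          = ((-1) ^ p * real p) * (x ^ Suc n / ?u ^ (p + 1) * H n) * (y ^ Suc r / ?v ^ 1)"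
        by (simp add: mult_ac del: power_Suc of_nat_Suc)
      also have "?c * ((-1) ^ p / (?u ^ p * (?u + ?v)\<^sup>2))
          = (-1) ^ p * (z ^ Suc n / ?u ^ p * H n) * (y ^ (Suc n + Suc r) / real (Suc n + Suc r) ^ 2)"
      proof -
        have "?c * ((-1) ^ p / (?u ^ p * (?u + ?v)\<^sup>2))
            = (x ^ Suc n * y ^ Suc r) * (H n * ((-1) ^ p / (?u ^ p * (?u + ?v)\<^sup>2)))"
          by (simp only: mult_ac)
        then show ?thesis
          unfolding xy[symmetric] of_nat_add by (simp add: mult_ac del: power_Suc of_nat_Suc)
      qed
      also have "?c * ((-1) ^ p * real p / (?u ^ (p + 1) * (?u + ?v)))
          = ((-1) ^ p * real p) * (z ^ Suc n / ?u ^ (p + 1) * H n) * (y ^ (Suc n + Suc r) / real (Suc n + Suc r) ^ 1)"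
      proof -
        have "?c * ((-1) ^ p * real p / (?u ^ (p + 1) * (?u + ?v)))
            = (x ^ Suc n * y ^ Suc r) * (H n * ((-1) ^ p * real p / (?u ^ (p + 1) * (?u + ?v))))"
          by (simp only: mult_ac)
        then show ?thesis
          unfolding xy[symmetric] of_nat_add by (simp add: mult_ac del: power_Suc of_nat_Suc)
      qed
      finally show ?thesis .
    qed
    have F_eq: "F n =
        (\<Sum>s=2..p. (real (s - 1) * (-1) ^ s) * (x ^ Suc n / ?u ^ s * H n) * polylog (p + 2 - s) y)
        - ((-1) ^ p * real p) * (x ^ Suc n / ?u ^ (p + 1) * H n) * polylog 1 y
        + (-1) ^ p * (z ^ Suc n / ?u ^ p * H n) * (polylog 2 y - gen_harm 2 (Suc n) y)
        + ((-1) ^ p * real p) * (z ^ Suc n / ?u ^ (p + 1) * H n) * (polylog 1 y - gen_harm 1 (Suc n) y)"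
      unfolding F_def G_def by (simp only: left_diff_distrib right_diff_distrib mult_ac)
    show ?thesis
      unfolding f_eq F_eq by (intro sums_add sums_diff sums_sum pole_0 pole_u)
  qed
  have F: "F sums
      ((\<Sum>s=2..p. real (s - 1) * ((-1) ^ s * polylog (p + 2 - s) y * D s x))
      - (-1) ^ p * real p * polylog 1 y * D (p + 1) x
      + (-1) ^ p * (polylog 2 y * D p z - suminf (G p 2))
      + (-1) ^ p * real p * (polylog 1 y * D (p + 1) z - suminf (G (p + 1) 1)))"
    unfolding F_def
    by (intro sums_add sums_diff sums_sum sums_mult Dx Dz G) (use p in auto)
  \<comment> \<open>On a diagonal the denominator is constant and \<open>y = a * x\<close> collects
    all powers of \<open>x\<close> into \<open>x ^ (N + 2)\<close>.\<close>
  have "(\<Sum>r\<le>N. f (N - r, r)) = x ^ (N + 2) / (real (N + 2))\<^sup>2 * triangle_sum p m a b N" for N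
  proof -
    have "f (N - r, r) = x ^ (N + 2) / (real (N + 2))\<^sup>2
        * (\<Sum>k\<le>N - r. a ^ Suc r / real (Suc r) ^ p * (b ^ Suc k / real (Suc k) ^ m))" if "r \<le> N" for r
    proof -
      have "x ^ Suc (N - r) * y ^ Suc r = x ^ (N + 2) * a ^ Suc r"
        using that by (simp add: y_def power_mult_distrib power_add[symmetric] mult_ac del: power_Suc)
      moreover have "real (Suc (N - r)) + real (Suc r) = real (N + 2)"
        using that by simp
      moreover have "f (N - r, r) = (x ^ Suc (N - r) * y ^ Suc r) * (H (N - r) / real (Suc r) ^ p)
          / (real (Suc (N - r)) + real (Suc r))\<^sup>2"
        by (simp add: f_def mult_ac del: power_Suc of_nat_Suc)
      ultimately have "f (N - r, r) = (x ^ (N + 2) * a ^ Suc r) * (H (N - r) / real (Suc r) ^ p) / (real (N + 2))\<^sup>2"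
        by (simp only:)
      then show ?thesis
        unfolding H_def gen_harm_eq_lessThan lessThan_Suc_atMost sum_distrib_left[symmetric]
        by (simp add: mult_ac del: power_Suc of_nat_Suc)
    qed
    then show ?thesis
      unfolding triangle_sum_def by (subst sum_distrib_left) (intro sum.cong refl, simp)
  qed
  then have "(\<Sum>N. x ^ (N + 2) / (real (N + 2))\<^sup>2 * triangle_sum p m a b N) = suminf F"
    using suminf_rows_eq_diagonals[OF f_summable rows] by simp
  also have "\<dots> = (\<Sum>s=2..p. real (s - 1) * ((-1) ^ s * polylog (p + 2 - s) y * D s x))
      - (-1) ^ p * real p * polylog 1 y * D (p + 1) x
      + (-1) ^ p * (polylog 2 y * D p z - suminf (G p 2))
      + (-1) ^ p * real p * (polylog 1 y * D (p + 1) z - suminf (G (p + 1) 1))"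
    using F by (rule sums_unique[symmetric])
  also have "(\<Sum>s=2..p. real (s - 1) * ((-1) ^ s * polylog (p + 2 - s) y * D s x))
      = (\<Sum>i=1..p-1. \<Sum>j=1..p-i. (-1) ^ (i + j) * polylog (p + 2 - i - j) y * D (i + j) x)"
    by (simp only: diff_diff_left sum_nested_eq_weighted_sum[symmetric])
  finally have series: "(\<Sum>N. x ^ (N + 2) / (real (N + 2))\<^sup>2 * triangle_sum p m a b N)
      = (\<Sum>i=1..p-1. \<Sum>j=1..p-i. (-1) ^ (i + j) * polylog (p + 2 - i - j) y * D (i + j) x)
      - (-1) ^ p * real p * polylog 1 y * D (p + 1) x
      + (-1) ^ p * (polylog 2 y * D p z - suminf (G p 2))
      + (-1) ^ p * real p * (polylog 1 y * D (p + 1) z - suminf (G (p + 1) 1))" .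
  have ln: "ln (1 - a * x) = - polylog 1 y"
    using polylog_1[OF y] by (simp add: y_def)
  \<comment> \<open>Stated for arbitrary reals, so that the comparison is a polynomial identity in
    atoms.\<close>
  have rearrange: "e * s2 - d - e * q * (- l1) * (dx - dz) + e * q * s1 - e * l2 * dp
      = - (d - e * q * l1 * dx + e * (l2 * dp - s2) + e * q * (l1 * dz - s1))"
    for e s2 d q l1 dx dz s1 l2 dp :: real
    by (simp add: algebra_simps)
  show ?thesis
    unfolding G_eq series ln
    unfolding y_def[symmetric] z_def[symmetric] D_def
    by (rule rearrange)
qed

theorem theorem3p9:
  fixes m p :: nat and a b x :: real
  assumes "m \<ge> 1" and "p \<ge> 1"
    and "\<bar>a\<bar> = \<bar>b\<bar>" and "\<bar>b\<bar> > 1"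
    and "\<bar>x\<bar> < inverse \<bar>a\<bar>"
  shows
    "(-1) ^ p * (\<Sum>n. gen_harm 2 (Suc n) (a * x) * gen_harm m (Suc n) b
                        / (a ^ Suc n * real (Suc n) ^ p))
     - (-1) ^ m * (\<Sum>n. gen_harm 2 (Suc n) (b * x) * gen_harm p (Suc n) a
                        / (b ^ Suc n * real (Suc n) ^ m))
     = (\<Sum>i=1..p-1. \<Sum>j=1..p-i.
          (-1) ^ (i + j) * polylog (p + 2 - i - j) (a * x) * dbl_polylog (real (i + j)) (real m) x b)
     - (\<Sum>i=1..m-1. \<Sum>j=1..m-i.
          (-1) ^ (i + j) * polylog (m + 2 - i - j) (b * x) * dbl_polylog (real (i + j)) (real p) x a)
     + (-1) ^ p * real p * ln (1 - a * x)
         * (dbl_polylog (real (p + 1)) (real m) x b - dbl_polylog (real (p + 1)) (real m) (inverse a) b)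
     - (-1) ^ m * real m * ln (1 - b * x)
         * (dbl_polylog (real (m + 1)) (real p) x a - dbl_polylog (real (m + 1)) (real p) (inverse b) a)
     - (-1) ^ p * real p * (\<Sum>n. gen_harm 1 (Suc n) (a * x) * gen_harm m (Suc n) b
                        / (a ^ Suc n * real (Suc n) ^ (p + 1)))
     + (-1) ^ m * real m * (\<Sum>n. gen_harm 1 (Suc n) (b * x) * gen_harm p (Suc n) a
                        / (b ^ Suc n * real (Suc n) ^ (m + 1)))
     + (-1) ^ p * polylog 2 (a * x) * dbl_polylog (real p) (real m) (inverse a) b
     - (-1) ^ m * polylog 2 (b * x) * dbl_polylog (real m) (real p) (inverse b) a"
proof -
  have x: "\<bar>x\<bar> < inverse \<bar>b\<bar>" and a: "\<bar>a\<bar> > 1"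
    using assms by simp_all
  show ?thesis
    \<comment> \<open>The second instance exchanges \<open>(p, a)\<close> with
      \<open>(m, b)\<close>. Both right sides agree by symmetry, and equating the left sides gives
      the claim.\<close>
    using sum_terms_eq_triangle_series[OF assms]
      sum_terms_eq_triangle_series[OF assms(2,1) assms(3)[symmetric] a x]
    unfolding triangle_sum_commute[of p m a b] by linarith
qed

end
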